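(* Let $q\ge1$, let $A=(a_1,\ldots,a_q)$, $B=(b_1,\ldots,b_q)$ be real vectors with $B\prec^W A$, let $\delta>0$ and let $\sigma$ be real. Then the function $$ x\mapsto\frac{{}_{q+1}F_q(\sigma,A+\delta;B+\delta;-x)}{{}_{q+1}F_q(\sigma,A;B;-x)} $$ is monotone decreasing on $(-1,\infty)$ if $\sigma>0$ and monotone increasing on $(-1,\infty)$ if $\sigma<0$.
   Context: $B\prec^W A$ means: $0<a_1\le\cdots\le a_q$, $0<b_1\le\cdots\le b_q$, and $\sum_{i=1}^{k}a_i\le\sum_{i=1}^{k}b_i$ for $k=1,\ldots,q$. For a vector $A$ and number $\delta$, $A+\delta=(a_1+\delta,\ldots,a_q+\delta)$. The generalized hypergeometric function is ${}_{q+1}F_q(\sigma,A;B;z)=\sum_{n=0}^{\infty}\frac{(\sigma)_n(a_1)_n\cdots(a_q)_n}{(b_1)_n\cdots(b_q)_n\,n!}z^n$ for $|z|<1$, extended by analytic continuation to $\mathbb{C}\setminus[1,\infty)$; $(a)_0=1$, $(a)_n=a(a+1)\cdots(a+n-1)$. *)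

theory Defs
  imports "HOL-Complex_Analysis.Complex_Analysis"
begin

text \<open>
  The argument order follows the notation \<open>B \<prec>\<^sup>W A\<close>.  Vectors are lists, so the partial sum
  \<open>a\<^sub>1 + \<dots> + a\<^sub>k\<close> is \<open>sum_list (take k A)\<close>.
\<close>

definition weak_supermajorized :: "real list \<Rightarrow> real list \<Rightarrow> bool" (infix "\<prec>\<^sup>W" 50) where
  "B \<prec>\<^sup>W A \<longleftrightarrow>
     length A = length B \<and>
     sorted A \<and> (\<forall>a\<in>set A. 0 < a) \<and>
     sorted B \<and> (\<forall>b\<in>set B. 0 < b) \<and>
     (\<forall>k\<in>{1..length A}. sum_list (take k A) \<le> sum_list (take k B))"

definition vec_shift :: "real list \<Rightarrow> real \<Rightarrow> real list" (infixl "+\<^sub>v" 65) where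
  "A +\<^sub>v \<delta> = map (\<lambda>a. a + \<delta>) A"

definition cut_plane :: "complex set" where
  "cut_plane = - (complex_of_real ` {1..})"

text \<open>
  Meant for \<open>length as = length bs + 1\<close> with no element of \<open>bs\<close> in \<open>{0, -1, -2, \<dots>}\<close>: then the
  series has radius of convergence at least 1, and its sum has an analytic continuation to the
  cut plane.  The continuation is unique there (lemma \<open>hypergeo_F_eqI\<close> below), so the choice
  operator is harmless; values on the cut \<open>[1, \<infinity>)\<close> are unspecified.
\<close>

definition hypergeo_F :: "complex list \<Rightarrow> complex list \<Rightarrow> complex \<Rightarrow> complex" where
  "hypergeo_F as bs =
     (SOME f. f holomorphic_on cut_plane \<and>
              (\<forall>z\<in>ball 0 1. f z = eval_fps (fps_hypergeo as bs 1) z))"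

abbreviation real_hypergeo_F :: "real \<Rightarrow> real list \<Rightarrow> real list \<Rightarrow> complex \<Rightarrow> complex" where
  "real_hypergeo_F \<sigma> A B \<equiv>
     hypergeo_F (map complex_of_real (\<sigma> # A)) (map complex_of_real B)"

lemma open_cut_plane: "open cut_plane"
proof -
  have "complex_of_real ` {1..} = \<real> \<inter> {z. 1 \<le> Re z}"
    by (auto elim!: Reals_cases)
  then have "closed (complex_of_real ` {1..})"
    by (simp add: closed_Int closed_complex_Reals closed_halfspace_Re_ge)
  then show ?thesis
    by (simp add: cut_plane_def open_Compl)
qed

lemma connected_cut_plane: "connected cut_plane"
proof (rule starlike_imp_connected)
  have "u *\<^sub>R z \<in> cut_plane" if z: "z \<in> cut_plane" and u: "0 \<le> u" "u \<le> 1" for u and z :: complex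
  proof (rule ccontr)
    assume "u *\<^sub>R z \<notin> cut_plane"
    then obtain t where t: "t \<ge> 1" "u *\<^sub>R z = complex_of_real t"
      by (auto simp: cut_plane_def)
    then have "u > 0"
      using u by (cases "u = 0") auto
    then have "z = complex_of_real (t / u)"
      using t(2) by (simp add: scaleR_conv_of_real field_simps)
    moreover have "t / u \<ge> 1"
      using t(1) u(2) \<open>u > 0\<close> by simp
    ultimately show False
      using z unfolding cut_plane_def by blast
  qed
  moreover have "0 \<in> cut_plane"
    by (auto simp: cut_plane_def)
  ultimately have "closed_segment 0 z \<subseteq> cut_plane" if "z \<in> cut_plane" for z
    using that by (auto simp: closed_segment_def)
  with \<open>0 \<in> cut_plane\<close> show "starlike cut_plane"
    unfolding starlike_def by blast
qed

lemma ball_subset_cut_plane: "ball 0 1 \<subseteq> cut_plane"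
proof
  fix z :: complex
  assume "z \<in> ball 0 1"
  then show "z \<in> cut_plane"
    by (auto simp: cut_plane_def norm_of_real)
qed

lemma hypergeo_F_eqI:
  assumes "f holomorphic_on cut_plane"
    and "\<And>z. z \<in> ball 0 1 \<Longrightarrow> f z = eval_fps (fps_hypergeo as bs 1) z"
    and "z \<in> cut_plane"
  shows "hypergeo_F as bs z = f z"
proof -
  have F: "hypergeo_F as bs holomorphic_on cut_plane \<and>
        (\<forall>z\<in>ball 0 1. hypergeo_F as bs z = eval_fps (fps_hypergeo as bs 1) z)"
    unfolding hypergeo_F_def by (rule someI[of _ f]) (use assms in auto)
  show ?thesis
    by (rule analytic_continuation_open[of "ball 0 1" cut_plane])
       (use F assms open_cut_plane connected_cut_plane ball_subset_cut_plane in simp_all)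
qed

end

theory Submission
  imports Defs "HOL-Probability.Probability"
begin

text \<open>
  The quotient \<open>\<Prod>\<^sub>i \<Gamma>(a\<^sub>i + s) \<Gamma>(b\<^sub>i) / (\<Gamma>(b\<^sub>i + s) \<Gamma>(a\<^sub>i))\<close> is the moment function \<open>E[T\<^sup>s]\<close> of a random
  variable \<open>T\<close> with values in \<open>[0, 1]\<close>. By Gauss' product for \<open>\<Gamma>\<close> it is a limit of finite products of
  factors \<open>\<Prod>\<^sub>i (b\<^sub>i + k + s) / (a\<^sub>i + k + s)\<close>, suitably normalised, and moment functions are closed
  under products (independent factors) and pointwise limits (Helly selection). A single such factor
  is handled by Robin Hood transfers, each of which contributes a mixture of the constant 1 and a
  product of two functions \<open>a / (a + s)\<close>.

  Hence \<open>F(\<sigma>, A; B; z) = E[(1 - zT)\<^sup>-\<^sup>\<sigma>]\<close> on the cut plane, and passing to \<open>A + \<delta>; B + \<delta>\<close> only inserts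
  the weight \<open>T\<^sup>\<delta>\<close>, up to a positive constant. Monotonicity of the ratio is then Chebyshev's
  correlation inequality, as \<open>T\<^sup>\<delta>\<close> increases with \<open>T\<close> while \<open>((1 + xT) / (1 + yT))\<^sup>\<sigma>\<close> is monotone.
\<close>

section \<open>Moment functions of random variables in the unit interval\<close>

text \<open>Measures live on the whole real line, where weak convergence of
  \<open>real_distribution\<close> is stated. Clamping inside the integrand replaces a support
  condition and keeps the integrands bounded.\<close>

definition clamp01 :: "real \<Rightarrow> real" where
  "clamp01 t = max 0 (min 1 t)"

lemma clamp01_nonneg [simp]: "0 \<le> clamp01 t"
  and clamp01_le_1 [simp]: "clamp01 t \<le> 1"
  by (simp_all add: clamp01_def)

lemma clamp01_eq: "0 \<le> t \<Longrightarrow> t \<le> 1 \<Longrightarrow> clamp01 t = t"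
  by (simp add: clamp01_def)

lemma borel_measurable_clamp01 [measurable]: "clamp01 \<in> borel_measurable borel"
  unfolding clamp01_def[abs_def] by measurable

lemma isCont_clamp01: "isCont clamp01 t"
  unfolding clamp01_def[abs_def] by (intro continuous_intros)

lemma clamp01_powr_le_1: "s \<ge> 0 \<Longrightarrow> clamp01 t powr s \<le> 1"
  using powr_mono2[of s "clamp01 t" 1] by simp

text \<open>The value at 0 is separate because \<open>0 powr 0 = 0\<close> in HOL and the measure may charge \<open>(-\<infinity>, 0]\<close>.\<close>

definition unit_mellin :: "real measure \<Rightarrow> (real \<Rightarrow> real) \<Rightarrow> bool" where
  "unit_mellin M f \<longleftrightarrow>
     real_distribution M \<and> f 0 = 1 \<and> (\<forall>s>0. f s = (LINT t|M. clamp01 t powr s))"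

lemma unit_mellin_cong:
  assumes "unit_mellin M f" "\<And>s. s \<ge> 0 \<Longrightarrow> f s = g s"
  shows "unit_mellin M g"
  using assms by (simp add: unit_mellin_def less_imp_le)

text \<open>Allows a moment function to be realised by a random variable on whichever probability
  space is convenient.\<close>

lemma unit_mellin_distr:
  assumes "prob_space N" "X \<in> borel_measurable N" "f 0 = 1"
    and "\<And>s. s > 0 \<Longrightarrow> f s = (LINT t|N. clamp01 (X t) powr s)"
  shows "unit_mellin (distr N borel X) f"
proof -
  interpret N: prob_space N by fact
  have "real_distribution (distr N borel X)"
    by (rule N.real_distribution_distr) fact
  then show ?thesis
    using assms by (auto simp: unit_mellin_def integral_distr)
qed

lemma unit_mellin_one: "\<exists>M. unit_mellin M (\<lambda>_. 1)"
proof
  show "unit_mellin (distr (measure_pmf (return_pmf ())) borel (\<lambda>_. 1)) (\<lambda>_. 1)"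
    by (rule unit_mellin_distr) (auto simp: clamp01_def measure_pmf.prob_space_axioms measure_pmf.prob_space)
qed

text \<open>For independent T and U, E[(TU)^s] = E[T^s] E[U^s]; the product measure supplies the
  independence.\<close>

lemma unit_mellin_mult:
  assumes "unit_mellin M f" "unit_mellin N g"
  shows "\<exists>K. unit_mellin K (\<lambda>s. f s * g s)"
proof
  interpret M: real_distribution M using assms by (simp add: unit_mellin_def)
  interpret N: real_distribution N using assms by (simp add: unit_mellin_def)
  interpret MN: pair_prob_space M N ..
  show "unit_mellin (distr (M \<Otimes>\<^sub>M N) borel (\<lambda>(t,u). clamp01 t * clamp01 u)) (\<lambda>s. f s * g s)"
  proof (rule unit_mellin_distr)
    fix s :: real assume s: "s > 0"
    have eq: "clamp01 (case x of (t,u) \<Rightarrow> clamp01 t * clamp01 u) powr s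
        = clamp01 (fst x) powr s * clamp01 (snd x) powr s" for x
      by (cases x) (simp add: clamp01_eq mult_le_one powr_mult)
    have int: "integrable (M \<Otimes>\<^sub>M N) (\<lambda>x. clamp01 (fst x) powr s * clamp01 (snd x) powr s)"
      by (rule MN.P.integrable_const_bound[of _ 1])
         (use s in \<open>auto intro!: AE_I2 mult_le_one clamp01_powr_le_1 simp: abs_mult\<close>)
    have "(LINT x|(M \<Otimes>\<^sub>M N). clamp01 (fst x) powr s * clamp01 (snd x) powr s)
        = (LINT t|M. LINT u|N. clamp01 t powr s * clamp01 u powr s)"
      using MN.integral_fst'[OF int] by simp
    also have "\<dots> = f s * g s"
      using assms s by (simp add: unit_mellin_def mult.commute)
    finally show "f s * g s = (LINT x|(M \<Otimes>\<^sub>M N). clamp01 (case x of (t,u) \<Rightarrow> clamp01 t * clamp01 u) powr s)"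
      by (simp add: eq)
  qed (use assms in \<open>auto simp: unit_mellin_def MN.P.prob_space_axioms\<close>)
qed

lemma unit_mellin_prod:
  assumes "finite I" "\<And>i. i \<in> I \<Longrightarrow> \<exists>M. unit_mellin M (f i)"
  shows "\<exists>M. unit_mellin M (\<lambda>s. \<Prod>i\<in>I. f i s)"
  using assms
proof (induction I)
  case empty
  then show ?case using unit_mellin_one by simp
next
  case (insert i I)
  then obtain M N where "unit_mellin M (f i)" "unit_mellin N (\<lambda>s. \<Prod>i\<in>I. f i s)"
    by blast
  from unit_mellin_mult[OF this] insert.hyps show ?case by simp
qed

text \<open>Toss a coin: with probability p take the constant 1, otherwise sample from M.\<close>

lemma unit_mellin_mix_one:
  assumes "unit_mellin M f" "0 \<le> p" "p \<le> 1"
  shows "\<exists>K. unit_mellin K (\<lambda>s. p + (1 - p) * f s)"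
proof
  interpret M: real_distribution M using assms by (simp add: unit_mellin_def)
  let ?B = "measure_pmf (bernoulli_pmf p)"
  interpret BM: pair_prob_space ?B M ..
  let ?X = "\<lambda>x. if fst x then 1 else snd x :: real"
  have [measurable]: "?X \<in> borel_measurable (?B \<Otimes>\<^sub>M M)"
    by measurable
  show "unit_mellin (distr (?B \<Otimes>\<^sub>M M) borel ?X) (\<lambda>s. p + (1 - p) * f s)"
  proof (rule unit_mellin_distr)
    fix s :: real assume s: "s > 0"
    have int: "integrable (?B \<Otimes>\<^sub>M M) (\<lambda>x. clamp01 (?X x) powr s)"
      by (rule BM.P.integrable_const_bound[of _ 1])
         (use s in \<open>auto intro!: AE_I2 clamp01_powr_le_1\<close>)
    have "(LINT x|(?B \<Otimes>\<^sub>M M). clamp01 (?X x) powr s)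
        = (LINT b|?B. LINT t|M. clamp01 (?X (b,t)) powr s)"
      using BM.integral_fst'[OF int] by simp
    also have "\<dots> = p + (1 - p) * f s"
      using assms s M.prob_space by (simp add: unit_mellin_def clamp01_eq algebra_simps)
    finally show "p + (1 - p) * f s = (LINT x|(?B \<Otimes>\<^sub>M M). clamp01 (?X x) powr s)" by simp
  qed (use assms in \<open>auto simp: unit_mellin_def BM.P.prob_space_axioms\<close>)
qed

text \<open>Take T = U^(1/a) with U uniform on [0,1]: E[U^(s/a)] = 1/(s/a + 1).\<close>

lemma unit_mellin_pole:
  assumes a: "a > 0"
  shows "\<exists>M. unit_mellin M (\<lambda>s. a / (a + s))"
proof
  let ?U = "uniform_measure lborel {0..1::real}"
  have U: "?U = density lborel (indicator {0..1})"
    by (simp add: uniform_measure_def divide_ennreal_def)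
  have "prob_space ?U" by (rule prob_space_uniform_measure) auto
  then show "unit_mellin (distr ?U borel (\<lambda>u. u powr (1/a))) (\<lambda>s. a / (a + s))"
  proof (rule unit_mellin_distr)
    fix s :: real assume s: "s > 0"
    have cont: "continuous_on {0..1} (\<lambda>u::real. u powr (s/a))"
      using s a by (intro continuous_on_powr' continuous_intros) auto
    have "(LINT u|?U. clamp01 (u powr (1/a)) powr s)
        = (LINT u|lborel. indicator {0..1} u *\<^sub>R clamp01 (u powr (1/a)) powr s)"
      unfolding U ennreal_indicator[symmetric] by (subst integral_density) auto
    also have "\<dots> = (LINT u:{0..1}|lborel. u powr (s/a))"
      unfolding set_lebesgue_integral_def
      using powr_mono2[of "1/a" _ 1] a
      by (intro Bochner_Integration.integral_cong) (auto simp: indicator_def clamp01_eq powr_powr)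
    also have "\<dots> = integral {0..1} (\<lambda>u. u powr (s/a))"
      by (rule set_borel_integral_eq_integral[OF borel_integrable_atLeastAtMost'[OF cont]])
    also have "\<dots> = 1 / (s/a + 1)"
      using has_integral_powr_from_0[of "s/a" 1] s a by (intro integral_unique) (simp add: less_trans[of "-1" 0])
    also have "\<dots> = a / (a + s)" using a s by (simp add: field_simps)
    finally show "a / (a + s) = (LINT u|?U. clamp01 (u powr (1/a)) powr s)" by simp
  qed (use a in auto)
qed

text \<open>Helly selection: the clamped laws sit on [0,1], so they are tight and a subsequence
  converges weakly. The value at 0 is assumed separately, since the convergence is exploited for s >
  0 only.\<close>

lemma unit_mellin_LIMSEQ:
  assumes f: "\<And>n. \<exists>M. unit_mellin M (f n)" and "g 0 = 1"
    and lim: "\<And>s. s > 0 \<Longrightarrow> (\<lambda>n. f n s) \<longlonglongrightarrow> g s"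
  shows "\<exists>M. unit_mellin M g"
proof -
  obtain M where M: "\<And>n. unit_mellin (M n) (f n)" using f by metis
  define N where "N = (\<lambda>n. distr (M n) borel clamp01)"
  have Md: "real_distribution (M n)" for n using M by (simp add: unit_mellin_def)
  have Nd: "real_distribution (N n)" for n
  proof -
    interpret real_distribution "M n" by (rule Md)
    show ?thesis unfolding N_def by (rule real_distribution_distr) simp
  qed
  have N: "f n s = (LINT t|N n. clamp01 t powr s)" if "s > 0" for n s
  proof -
    interpret real_distribution "M n" by (rule Md)
    show ?thesis
      using M[of n] that by (simp add: unit_mellin_def N_def integral_distr clamp01_eq)
  qed
  \<comment> \<open>\<open>tight\<close> speaks of intervals open on the left, and 0 may carry mass;
    hence the left end -1.\<close>
  have N1: "measure (N n) {-1<..1} = 1" for n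
  proof -
    interpret real_distribution "M n" by (rule Md)
    have "clamp01 -` {-1<..1} \<inter> space (M n) = space (M n)"
      using clamp01_nonneg clamp01_le_1 by (force intro: less_le_trans[of "-1" 0])
    then show ?thesis
      unfolding N_def using prob_space by (subst measure_distr) auto
  qed
  have "tight N"
    unfolding tight_def
  proof (intro conjI allI impI Nd)
    fix \<epsilon> :: real assume "\<epsilon> > 0"
    then have "-1 < (1::real) \<and> (\<forall>n. measure (N n) {-1<..1} > 1 - \<epsilon>)"
      by (simp add: N1)
    then show "\<exists>a b. a < b \<and> (\<forall>n. measure (N n) {a<..b} > 1 - \<epsilon>)" by blast
  qed
  from tight_imp_convergent_subsubsequence[OF this, of id]
  obtain r K where r: "strict_mono r" and K: "real_distribution K" "weak_conv_m (N \<circ> id \<circ> r) K"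
    by (auto simp: strict_mono_id id_def strict_mono_def)
  have "g s = (LINT t|K. clamp01 t powr s)" if s: "s > 0" for s
  proof -
    have "(\<lambda>n. LINT t|(N \<circ> id \<circ> r) n. clamp01 t powr s) \<longlonglongrightarrow> (LINT t|K. clamp01 t powr s)"
    proof (rule weak_conv_imp_integral_bdd_continuous_conv[of _ _ _ 1])
      \<comment> \<open>Continuity where the clamped value is 0 rests on s > 0.\<close>
      show "isCont (\<lambda>t. clamp01 t powr s) t" for t
        unfolding isCont_def using s isCont_clamp01[of t]
        by (intro tendsto_powr2 tendsto_const) (auto simp: isCont_def)
    qed (use Nd K s in \<open>auto simp: clamp01_powr_le_1 less_imp_le o_def\<close>)
    then have "(\<lambda>n. f (r n) s) \<longlonglongrightarrow> (LINT t|K. clamp01 t powr s)"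
      by (simp add: N[OF s])
    moreover have "(\<lambda>n. f (r n) s) \<longlonglongrightarrow> g s"
      using LIMSEQ_subseq_LIMSEQ[OF lim[OF s] r] by (simp add: o_def)
    ultimately show ?thesis by (rule LIMSEQ_unique[rotated])
  qed
  then show ?thesis using K \<open>g 0 = 1\<close> by (auto simp: unit_mellin_def)
qed

section \<open>Gamma quotients under weak supermajorization\<close>

text \<open>One factor of Gauss' product for a Gamma quotient; \<open>a / b\<close> normalises the
  value at s = 0 to 1.\<close>

definition norm_ratio :: "real \<Rightarrow> real \<Rightarrow> real \<Rightarrow> real" where
  "norm_ratio a b s = (b + s) / (a + s) * (a / b)"

text \<open>Partial fractions give a/b + (1 - a/b) * a/(a + s), a mixture of 1 and a pole because a
  \<le> b.\<close>

lemma unit_mellin_norm_ratio: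
  assumes "0 < a" "a \<le> b"
  shows "\<exists>M. unit_mellin M (norm_ratio a b)"
proof -
  obtain N where "unit_mellin N (\<lambda>s. a / (a + s))"
    using unit_mellin_pole assms(1) by blast
  moreover have "0 \<le> a / b" "a / b \<le> 1" using assms by simp_all
  ultimately obtain M where M: "unit_mellin M (\<lambda>s. a / b + (1 - a / b) * (a / (a + s)))"
    using unit_mellin_mix_one by blast
  have "unit_mellin M (norm_ratio a b)"
    by (rule unit_mellin_cong[OF M])
       (use assms in \<open>simp add: norm_ratio_def divide_simps, simp add: algebra_simps\<close>)
  then show ?thesis ..
qed

text \<open>As the sums agree, (b1 + s)(b2 + s) - (a1 + s)(a2 + s) is the constant b1 b2 - a1 a2
  \<ge> 0. So the product is a mixture of 1 and two poles multiplied together. The weight p of 1 is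
  the limit of the product as s tends to infinity.\<close>

lemma unit_mellin_transfer:
  assumes a: "0 < a1" "0 < a2" and b: "0 < b1" "0 < b2"
    and sum: "b1 + b2 = a1 + a2" and prod: "a1 * a2 \<le> b1 * b2"
  shows "\<exists>M. unit_mellin M (\<lambda>s. norm_ratio a1 b1 s * norm_ratio a2 b2 s)"
proof -
  obtain N1 N2 where "unit_mellin N1 (\<lambda>s. a1 / (a1 + s))" "unit_mellin N2 (\<lambda>s. a2 / (a2 + s))"
    using unit_mellin_pole a by blast
  from unit_mellin_mult[OF this]
  obtain N where "unit_mellin N (\<lambda>s. a1 / (a1 + s) * (a2 / (a2 + s)))" by blast
  moreover define p where "p = a1 * a2 / (b1 * b2)"
  moreover have p: "0 \<le> p" "p \<le> 1" using a b prod by (simp_all add: p_def)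
  ultimately obtain M where
    M: "unit_mellin M (\<lambda>s. p + (1 - p) * (a1 / (a1 + s) * (a2 / (a2 + s))))"
    using unit_mellin_mix_one by blast
  have "unit_mellin M (\<lambda>s. norm_ratio a1 b1 s * norm_ratio a2 b2 s)"
  proof (rule unit_mellin_cong[OF M])
    fix s :: real assume s: "s \<ge> 0"
    have pos: "a1 + s > 0" "a2 + s > 0" using a s by auto
    have "p + (1 - p) * (a1 / (a1 + s) * (a2 / (a2 + s)))
        = p * (((a1 + s) * (a2 + s) + (b1 * b2 - a1 * a2)) / ((a1 + s) * (a2 + s)))"
    proof -
      have "p * (b1 * b2) = a1 * a2" using b by (simp add: p_def)
      then have "p * (b1 * b2 - a1 * a2) = (1 - p) * (a1 * a2)" by algebra
      moreover have "p * ((D + e) / D) = p + p * e / D" if "D \<noteq> 0" for D e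
        using that by (simp add: field_simps)
      moreover have "(a1 + s) * (a2 + s) \<noteq> 0" using pos by simp
      ultimately show ?thesis by simp
    qed
    also have "(a1 + s) * (a2 + s) + (b1 * b2 - a1 * a2) = (b1 + s) * (b2 + s)"
      using sum by algebra
    also have "p * (\<dots> / ((a1 + s) * (a2 + s))) = norm_ratio a1 b1 s * norm_ratio a2 b2 s"
      by (simp add: p_def norm_ratio_def ac_simps)
    finally show "p + (1 - p) * (a1 / (a1 + s) * (a2 / (a2 + s)))
      = norm_ratio a1 b1 s * norm_ratio a2 b2 s" .
  qed
  then show ?thesis ..
qed

lemma norm_ratio_self: "0 < a \<Longrightarrow> 0 \<le> s \<Longrightarrow> norm_ratio a a s = 1"
  by (simp add: norm_ratio_def)

lemma norm_ratio_chain: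
  "0 < c \<Longrightarrow> 0 \<le> s \<Longrightarrow> norm_ratio a c s * norm_ratio c b s = norm_ratio a b s"
  by (simp add: norm_ratio_def)

text \<open>
  If some \<open>a\<^sub>j > b\<^sub>j\<close>, then some earlier \<open>a\<^sub>i < b\<^sub>i\<close>; moving mass from \<open>a\<^sub>j\<close> to \<open>a\<^sub>i\<close> until one of
  them meets its target keeps all hypotheses and costs one factor of \<open>unit_mellin_transfer\<close>.
\<close>

lemma unit_mellin_prod_norm_ratio:
  fixes a b :: "nat \<Rightarrow> real"
  assumes "\<And>i. i < q \<Longrightarrow> 0 < a i" "\<And>i. i < q \<Longrightarrow> 0 < b i"
    and "\<And>i j. i \<le> j \<Longrightarrow> j < q \<Longrightarrow> b i \<le> b j"
    and "\<And>k. k \<le> q \<Longrightarrow> (\<Sum>i<k. a i) \<le> (\<Sum>i<k. b i)"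
  shows "\<exists>M. unit_mellin M (\<lambda>s. \<Prod>i<q. norm_ratio (a i) (b i) s)"
  using assms
proof (induction "card {i. i < q \<and> a i \<noteq> b i}" arbitrary: a rule: less_induct)
  case less
  note a_pos = less.prems(1) and b_pos = less.prems(2) and b_mono = less.prems(3)
    and major = less.prems(4)
  show ?case
  proof (cases "\<forall>i<q. a i \<le> b i")
    case True
    then show ?thesis
      using a_pos by (intro unit_mellin_prod) (auto intro: unit_mellin_norm_ratio)
  next
    case False
    define j where "j = (LEAST j. j < q \<and> b j < a j)"
    have "j < q \<and> b j < a j"
      unfolding j_def using False by - (rule LeastI_ex, auto simp: not_le)
    then have j: "j < q" "b j < a j" by auto
    have before: "a i \<le> b i" if "i < j" for i
    proof -
      have "i < q" using that j by simp
      moreover have "\<not> (i < q \<and> b i < a i)"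
        using that unfolding j_def by (rule not_less_Least)
      ultimately show ?thesis by simp
    qed
    \<comment> \<open>Otherwise a \<ge> b at every index before j, and together with a j > b j the
      partial sum through j would violate the majorization.\<close>
    obtain i where i: "i < j" "a i < b i"
    proof (rule ccontr)
      assume "\<not> thesis"
      then have "(\<Sum>i<j. a i) \<ge> (\<Sum>i<j. b i)"
        using that by (intro sum_mono) (force simp: not_less[symmetric])
      then show False using major[of "Suc j"] j by simp
    qed
    \<comment> \<open>The largest amount that overshoots neither target; it meets at least one, so
      fewer indices disagree afterwards.\<close>
    define e where "e = min (b i - a i) (a j - b j)"
    have e: "e > 0" "a i + e \<le> b i" "b j \<le> a j - e" using i j by (auto simp: e_def)
    \<comment> \<open>The order of b enters here: a i + e \<le> b i \<le> b j \<le> a j - e, so the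
      transfer brings the two entries closer. It may leave a unsorted, which is why the induction
      asks for order of b only.\<close>
    have bij: "b i \<le> b j" using b_mono i j by simp
    define a' where "a' = a(i := a i + e, j := a j - e)"
    have a'i: "a' i = a i + e" and a'j: "a' j = a j - e" using i by (auto simp: a'_def)
    have a'_else: "a' k = a k" if "k \<noteq> i" "k \<noteq> j" for k using that by (simp add: a'_def)
    have a'_pos: "0 < a' k" if "k < q" for k
      using that a_pos[of k] b_pos[of k] e by (auto simp: a'_def)
    have "\<exists>M. unit_mellin M (\<lambda>s. \<Prod>k<q. norm_ratio (a' k) (b k) s)"
    proof (rule less.hyps)
      have "{k. k < q \<and> a' k \<noteq> b k} \<subset> {k. k < q \<and> a k \<noteq> b k}"
      proof (rule psubsetI)
        show "{k. k < q \<and> a' k \<noteq> b k} \<subseteq> {k. k < q \<and> a k \<noteq> b k}"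
          using i j by (auto simp: a'_def split: if_splits)
        have "a' i = b i \<or> a' j = b j" by (auto simp: a'i a'j e_def)
        moreover have "i \<in> {k. k < q \<and> a k \<noteq> b k}" "j \<in> {k. k < q \<and> a k \<noteq> b k}"
          using i j by auto
        ultimately show "{k. k < q \<and> a' k \<noteq> b k} \<noteq> {k. k < q \<and> a k \<noteq> b k}"
          by blast
      qed
      then show "card {k. k < q \<and> a' k \<noteq> b k} < card {k. k < q \<and> a k \<noteq> b k}"
        by (intro psubset_card_mono) auto
    next
      fix k assume k: "k \<le> q"
      show "(\<Sum>l<k. a' l) \<le> (\<Sum>l<k. b l)"
      \<comment> \<open>Beyond j the two changes cancel; up to j the bound holds entry by entry,
        since j is the first index with a > b.\<close>
      proof (cases "j < k")
        case True
        have "(\<Sum>l<k. a' l) = (\<Sum>l<k. a l + (if l = i then e else 0) - (if l = j then e else 0))"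
          using i by (intro sum.cong) (auto simp: a'_def)
        also have "\<dots> = (\<Sum>l<k. a l)"
          using True i by (simp add: sum.distrib sum_subtractf)
        finally show ?thesis using major[OF k] by simp
      next
        case False
        then show ?thesis
          using before e by (intro sum_mono) (auto simp: a'_def)
      qed
    qed (use a'_pos b_pos b_mono in auto)
    moreover have "\<exists>M. unit_mellin M (\<lambda>s. norm_ratio (a i) (a' i) s * norm_ratio (a j) (a' j) s)"
    proof (rule unit_mellin_transfer)
      \<comment> \<open>This is the amount by which the transfer increases the product of the two
        entries.\<close>
      have "0 \<le> e * (a j - e - a i)" using e bij by (intro mult_nonneg_nonneg) auto
      then show "a i * a j \<le> a' i * a' j" by (simp add: a'i a'j algebra_simps)
    qed (use a_pos[of i] a_pos[of j] a'_pos[of i] a'_pos[of j] i j a'i a'j in auto)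
    ultimately obtain M where M: "unit_mellin M (\<lambda>s.
        (norm_ratio (a i) (a' i) s * norm_ratio (a j) (a' j) s)
        * (\<Prod>k<q. norm_ratio (a' k) (b k) s))"
      using unit_mellin_mult by blast
    have "unit_mellin M (\<lambda>s. \<Prod>k<q. norm_ratio (a k) (b k) s)"
    proof (rule unit_mellin_cong[OF M])
      fix s :: real assume s: "s \<ge> 0"
      \<comment> \<open>Only i and j moved, so the two transfer factors form the full product from a
        to a', which telescopes with the one from a' to b.\<close>
      have "(\<Prod>k<q. norm_ratio (a k) (a' k) s) = (\<Prod>k\<in>{i,j}. norm_ratio (a k) (a' k) s)"
        using i j a_pos s
        by (intro prod.mono_neutral_right) (auto simp: a'_else norm_ratio_self)
      also have "\<dots> = norm_ratio (a i) (a' i) s * norm_ratio (a j) (a' j) s"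
        using i by simp
      finally have "norm_ratio (a i) (a' i) s * norm_ratio (a j) (a' j) s
          * (\<Prod>k<q. norm_ratio (a' k) (b k) s)
        = (\<Prod>k<q. norm_ratio (a k) (a' k) s * norm_ratio (a' k) (b k) s)"
        by (simp add: prod.distrib)
      also have "\<dots> = (\<Prod>k<q. norm_ratio (a k) (b k) s)"
        using a'_pos s by (intro prod.cong refl norm_ratio_chain) auto
      finally show "norm_ratio (a i) (a' i) s * norm_ratio (a j) (a' j) s
          * (\<Prod>k<q. norm_ratio (a' k) (b k) s) = (\<Prod>k<q. norm_ratio (a k) (b k) s)" .
    qed
    then show ?thesis ..
  qed
qed

text \<open>In the quotient of four Gamma series the factorials and the powers of n cancel; the
  Pochhammer quotients that remain are the finite product.\<close>

lemma prod_norm_ratio_LIMSEQ: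
  fixes a b s :: real
  assumes "0 < a" "0 < b" "0 \<le> s"
  shows "(\<lambda>n. \<Prod>k\<le>n. norm_ratio (a + real k) (b + real k) s)
    \<longlonglongrightarrow> (Gamma (a + s) / Gamma a) / (Gamma (b + s) / Gamma b)"
proof -
  let ?G = "Gamma_series :: real \<Rightarrow> nat \<Rightarrow> real"
  have "(\<lambda>n. (?G (a + s) n / ?G a n) / (?G (b + s) n / ?G b n))
      \<longlonglongrightarrow> (Gamma (a + s) / Gamma a) / (Gamma (b + s) / Gamma b)"
    using assms by (intro tendsto_divide Gamma_series_LIMSEQ) (simp_all add: less_imp_neq[symmetric] Gamma_real_pos)
  moreover have "(?G (a + s) n / ?G a n) / (?G (b + s) n / ?G b n)
      = (\<Prod>k\<le>n. norm_ratio (a + real k) (b + real k) s)" for n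
  proof -
    let ?P = "\<lambda>x. pochhammer x (Suc n) :: real" and ?E = "exp (s * ln (real n))"
    have P: "?P x = (\<Prod>k\<le>n. x + real k)" for x :: real
      by (simp add: pochhammer_prod atLeast0LessThan lessThan_Suc_atMost)
    have P0: "?P x \<noteq> 0" if "x > 0" for x :: real
      using pochhammer_pos[OF that, of "Suc n"] by simp
    have G: "?G (x + s) n / ?G x n = ?E * (?P x / ?P (x + s))" if "x > 0" for x
    proof -
      have "exp ((x + s) * ln (real n)) = exp (x * ln (real n)) * ?E"
        by (simp add: distrib_right exp_add)
      then show ?thesis by (simp add: Gamma_series_def)
    qed
    have "(\<Prod>k\<le>n. norm_ratio (a + real k) (b + real k) s) = ?P (b + s) / ?P (a + s) * (?P a / ?P b)"
      by (simp add: P norm_ratio_def prod.distrib prod_dividef ac_simps)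
    then show ?thesis using assms by (simp add: G)
  qed
  ultimately show ?thesis by simp
qed

text \<open>Adding k to every entry preserves positivity, order and the inequalities of partial
  sums, so each level k of Gauss' product is a moment function.\<close>

lemma unit_mellin_Gamma_ratio:
  fixes a b :: "nat \<Rightarrow> real"
  assumes "\<And>i. i < q \<Longrightarrow> 0 < a i" "\<And>i. i < q \<Longrightarrow> 0 < b i"
    and "\<And>i j. i \<le> j \<Longrightarrow> j < q \<Longrightarrow> b i \<le> b j"
    and "\<And>k. k \<le> q \<Longrightarrow> (\<Sum>i<k. a i) \<le> (\<Sum>i<k. b i)"
  shows "\<exists>M. unit_mellin M
    (\<lambda>s. \<Prod>i<q. (Gamma (a i + s) / Gamma (a i)) / (Gamma (b i + s) / Gamma (b i)))"
proof (rule unit_mellin_LIMSEQ)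
  show "\<exists>M. unit_mellin M
    (\<lambda>s. \<Prod>k\<le>n. \<Prod>i<q. norm_ratio (a i + real k) (b i + real k) s)" for n :: nat
  proof (rule unit_mellin_prod)
    show "\<exists>M. unit_mellin M (\<lambda>s. \<Prod>i<q. norm_ratio (a i + real k) (b i + real k) s)" for k
      using assms by (intro unit_mellin_prod_norm_ratio) (auto simp: sum.distrib add_pos_nonneg)
  qed simp
next
  fix s :: real assume "s > 0"
  have "(\<lambda>n. \<Prod>i<q. \<Prod>k\<le>n. norm_ratio (a i + real k) (b i + real k) s) \<longlonglongrightarrow>
    (\<Prod>i<q. (Gamma (a i + s) / Gamma (a i)) / (Gamma (b i + s) / Gamma (b i)))"
    using assms \<open>s > 0\<close> by (intro tendsto_prod prod_norm_ratio_LIMSEQ) auto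
  \<comment> \<open>Convergence is known for each i separately, the moment property for each k;
    swapping the products reconciles them.\<close>
  then show "(\<lambda>n. \<Prod>k\<le>n. \<Prod>i<q. norm_ratio (a i + real k) (b i + real k) s) \<longlonglongrightarrow>
    (\<Prod>i<q. (Gamma (a i + s) / Gamma (a i)) / (Gamma (b i + s) / Gamma (b i)))"
    by (subst prod.swap)
qed (use assms in \<open>simp add: Gamma_real_pos less_imp_neq[symmetric]\<close>)

section \<open>Generalized Stieltjes transforms\<close>

lemma continuous_on_clamp01: "continuous_on {0..1} f \<Longrightarrow> continuous_on UNIV (\<lambda>t. f (clamp01 t))"
  by (rule continuous_on_compose2[of _ f])
     (auto intro: continuous_at_imp_continuous_on isCont_clamp01)

lemma borel_measurable_comp_clamp01:
  fixes f :: "real \<Rightarrow> 'a::{banach, second_countable_topology}"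
  assumes "continuous_on {0..1} f"
  shows "(\<lambda>t. f (clamp01 t)) \<in> borel_measurable borel"
  by (rule borel_measurable_continuous_onI[OF continuous_on_clamp01[OF assms]])

lemma (in real_distribution) integrable_comp_clamp01:
  fixes f :: "real \<Rightarrow> 'a::{real_normed_field, banach, second_countable_topology}"
  assumes "continuous_on {0..1} f" and [measurable]: "w \<in> borel_measurable borel"
    and "\<And>t. \<bar>w t\<bar> \<le> 1"
  shows "integrable M (\<lambda>t. of_real (w t) * f (clamp01 t))"
proof -
  have [measurable]: "(\<lambda>t. f (clamp01 t)) \<in> borel_measurable borel"
    by (rule borel_measurable_comp_clamp01) fact
  have "bounded (f ` {0..1})"
    by (intro compact_imp_bounded compact_continuous_image assms) auto
  then obtain B where B: "\<And>c. c \<in> {0..1} \<Longrightarrow> norm (f c) \<le> B"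
    unfolding bounded_iff by blast
  have "norm (of_real (w t) * f (clamp01 t)) \<le> 1 * B" for t
    unfolding norm_mult using assms(3) by (intro mult_mono B) auto
  then show ?thesis
    by (intro integrable_const_bound[of _ B] AE_I2) auto
qed

text \<open>By the mean value inequality, a bound for \<open>k'\<close> on a closed disc times [0,1]
  dominates the difference quotients; dominated convergence along sequences then gives the
  derivative.\<close>

lemma (in real_distribution) holomorphic_on_integral_clamp01:
  fixes k k' :: "complex \<Rightarrow> real \<Rightarrow> complex"
  assumes U: "open U"
    and k: "\<And>z. z \<in> U \<Longrightarrow> continuous_on {0..1} (k z)"
    and k': "continuous_on (U \<times> {0..1}) (\<lambda>(z,c). k' z c)"
    and deriv: "\<And>z c. z \<in> U \<Longrightarrow> c \<in> {0..1} \<Longrightarrow> ((\<lambda>z. k z c) has_field_derivative k' z c) (at z)"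
    and w [measurable]: "w \<in> borel_measurable borel" and w1: "\<And>t. \<bar>w t\<bar> \<le> 1"
  shows "(\<lambda>z. LINT t|M. of_real (w t) * k z (clamp01 t)) holomorphic_on U"
proof (rule holomorphic_onI)
  let ?F = "\<lambda>z. LINT t|M. of_real (w t) * k z (clamp01 t)"
  fix z assume z: "z \<in> U"
  obtain r where r: "r > 0" "cball z r \<subseteq> U" using U z open_contains_cball by blast
  have "bounded ((\<lambda>(z,c). k' z c) ` (cball z r \<times> {0..1}))"
    using r by (intro compact_imp_bounded compact_continuous_image compact_Times
        continuous_on_subset[OF k']) auto
  then obtain B where B: "\<And>y c. y \<in> cball z r \<Longrightarrow> c \<in> {0..1} \<Longrightarrow> norm (k' y c) \<le> B"
    unfolding bounded_iff by (metis (no_types, lifting) SigmaI case_prod_conv image_eqI)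
  have "((\<lambda>y. (?F y - ?F z) / (y - z)) \<longlongrightarrow> (LINT t|M. of_real (w t) * k' z (clamp01 t)))
      (at z within ball z r)"
    unfolding tendsto_at_iff_sequentially
  proof (intro allI impI)
    fix Y assume Y: "\<forall>i. Y i \<in> ball z r - {z}" and lim: "Y \<longlonglongrightarrow> z"
    have YU: "Y i \<in> U" for i using Y r by (auto dest!: spec[of _ i] intro!: subsetD[OF r(2)])
    have [measurable]: "(\<lambda>t. k y (clamp01 t)) \<in> borel_measurable borel" if "y \<in> U" for y
      using k[OF that] by (rule borel_measurable_comp_clamp01)
    let ?q = "\<lambda>i t. of_real (w t) * ((k (Y i) (clamp01 t) - k z (clamp01 t)) / (Y i - z))"
    have "continuous_on {0..1} (k' z)"
      by (rule continuous_on_compose2[OF k', of _ "\<lambda>c. (z, c)", simplified])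
         (use z in \<open>auto intro!: continuous_intros\<close>)
    then have [measurable]: "(\<lambda>t. k' z (clamp01 t)) \<in> borel_measurable borel"
      by (rule borel_measurable_comp_clamp01)
    have "(\<lambda>i. LINT t|M. ?q i t) \<longlonglongrightarrow> (LINT t|M. of_real (w t) * k' z (clamp01 t))"
    proof (rule integral_dominated_convergence[where w = "\<lambda>_. B"])
      show "AE t in M. (\<lambda>i. ?q i t) \<longlonglongrightarrow> of_real (w t) * k' z (clamp01 t)"
      proof (intro AE_I2 tendsto_mult tendsto_const)
        fix t
        have "((\<lambda>y. (k y (clamp01 t) - k z (clamp01 t)) / (y - z)) \<longlongrightarrow> k' z (clamp01 t)) (at z)"
          using deriv[OF z, of "clamp01 t"] by (simp add: has_field_derivative_iff)
        then show "(\<lambda>i. (k (Y i) (clamp01 t) - k z (clamp01 t)) / (Y i - z)) \<longlonglongrightarrow> k' z (clamp01 t)"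
          using Y lim unfolding tendsto_at_iff_sequentially by (auto simp: o_def)
      qed
      show "AE t in M. norm (?q i t) \<le> B" for i
      proof (rule AE_I2)
        fix t
        have "norm (k (Y i) (clamp01 t) - k z (clamp01 t)) \<le> B * norm (Y i - z)"
        proof (rule field_differentiable_bound[of "cball z r" "\<lambda>z. k z (clamp01 t)"])
          show "((\<lambda>z. k z (clamp01 t)) has_field_derivative k' y (clamp01 t)) (at y within cball z r)"
            if "y \<in> cball z r" for y
            by (rule has_field_derivative_at_within, rule deriv) (use r(2) that in auto)
        qed (use B Y r in \<open>auto simp: less_imp_le\<close>)
        moreover have "Y i \<noteq> z" using Y by auto
        ultimately have "norm ((k (Y i) (clamp01 t) - k z (clamp01 t)) / (Y i - z)) \<le> B"
          by (simp add: norm_divide divide_le_eq)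
        then show "norm (?q i t) \<le> B"
          using mult_mono[OF w1[of t], of _ B] unfolding norm_mult by simp
      qed
    qed (use YU z in measurable)
    moreover have "(LINT t|M. ?q i t) = (?F (Y i) - ?F z) / (Y i - z)" for i
    proof -
      have "(LINT t|M. ?q i t) = (LINT t|M. (of_real (w t) * k (Y i) (clamp01 t)
          - of_real (w t) * k z (clamp01 t)) / (Y i - z))"
        by (intro Bochner_Integration.integral_cong) (simp_all add: right_diff_distrib)
      also have "\<dots> = (?F (Y i) - ?F z) / (Y i - z)"
        using integrable_comp_clamp01[OF k w w1] YU z by simp
      finally show ?thesis .
    qed
    ultimately show "((\<lambda>y. (?F y - ?F z) / (y - z)) \<circ> Y) \<longlonglongrightarrow> (LINT t|M. of_real (w t) * k' z (clamp01 t))"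
      by (simp only: o_def)
  qed
  then have "(?F has_field_derivative (LINT t|M. of_real (w t) * k' z (clamp01 t))) (at z)"
    using r by (simp add: has_field_derivative_iff at_within_open[of z "ball z r"])
  then show "?F field_differentiable (at z within U)"
    by (auto simp: field_differentiable_def intro: has_field_derivative_at_within)
qed

section \<open>The power kernel, its binomial series and hypergeometric functions\<close>

lemma binomial_series_pochhammer:
  fixes z :: complex
  assumes "norm z < 1"
  shows "(\<lambda>n. of_real (pochhammer \<sigma> n / fact n) * z ^ n) sums (1 - z) powr of_real (- \<sigma>)"
proof -
  have "(complex_of_real (- \<sigma>) gchoose n) * (- z) ^ n = of_real (pochhammer \<sigma> n / fact n) * z ^ n" for n
    by (simp add: gbinomial_pochhammer power_minus[of z] pochhammer_of_real)
  then show ?thesis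
    using gen_binomial_complex[of "-z" "of_real (- \<sigma>)"] assms by simp
qed

text \<open>Keeps the base of the power off the branch cut: 1 - zc = r \<le> 0 forces c > 0 and z =
  (1 - r)/c \<ge> 1.\<close>

lemma cut_plane_nonpos_Reals:
  assumes "z \<in> cut_plane" "c \<in> {0..1}"
  shows "1 - z * of_real c \<notin> \<real>\<^sub>\<le>\<^sub>0"
proof
  assume "1 - z * of_real c \<in> \<real>\<^sub>\<le>\<^sub>0"
  then obtain r where r: "1 - z * of_real c = of_real r" "r \<le> 0"
    by (auto elim: nonpos_Reals_cases)
  have "r \<noteq> 1" using r(2) by simp
  with r have c: "c > 0" using assms by (cases "c = 0") auto
  with r(1) have "z = of_real ((1 - r) / c)" by (simp add: field_simps)
  moreover have "(1 - r) / c \<ge> 1" using r c assms by (simp add: field_simps)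
  ultimately show False using assms(1) unfolding cut_plane_def by blast
qed

lemma one_plus_mult_pos:
  fixes x c :: real
  assumes "x > -1" "c \<in> {0..1}"
  shows "0 < 1 + x * c"
proof (cases "x \<ge> 0")
  case False
  have "- x * c \<le> - x" using assms False by (intro mult_left_le) auto
  then show ?thesis using assms by simp
qed (use assms in \<open>simp add: add_pos_nonneg\<close>)

text \<open>A weight beside the measure lets one M serve both hypergeometric functions: w = 1 for
  the denominator, the clamped t to the power \<delta> for the numerator.\<close>

definition stieltjes :: "real measure \<Rightarrow> (real \<Rightarrow> real) \<Rightarrow> real \<Rightarrow> complex \<Rightarrow> complex" where
  "stieltjes M w \<sigma> z = (LINT t|M. of_real (w t) * (1 - z * of_real (clamp01 t)) powr of_real (- \<sigma>))"

context real_distribution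
begin

lemma holomorphic_stieltjes:
  assumes w: "w \<in> borel_measurable borel" "\<And>t. \<bar>w t\<bar> \<le> 1"
  shows "stieltjes M w \<sigma> holomorphic_on cut_plane"
  unfolding stieltjes_def[abs_def]
proof (rule holomorphic_on_integral_clamp01[where
      k' = "\<lambda>z c. of_real \<sigma> * of_real c * (1 - z * of_real c) powr (of_real (- \<sigma>) - 1)"])
  show "continuous_on {0..1} (\<lambda>c. (1 - z * complex_of_real c) powr of_real (- \<sigma>))"
    if "z \<in> cut_plane" for z
    unfolding continuous_on_def
    by (intro ballI tendsto_powr_complex cut_plane_nonpos_Reals[OF that] tendsto_intros) auto
  show "continuous_on (cut_plane \<times> {0..1}) (\<lambda>(z, c). of_real \<sigma> * of_real c *
      (1 - z * complex_of_real c) powr (of_real (- \<sigma>) - 1))"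
    unfolding continuous_on_def case_prod_unfold
    by (intro ballI tendsto_mult tendsto_powr_complex cut_plane_nonpos_Reals tendsto_intros) auto
  show "((\<lambda>z. (1 - z * complex_of_real c) powr of_real (- \<sigma>)) has_field_derivative
      of_real \<sigma> * of_real c * (1 - z * of_real c) powr (of_real (- \<sigma>) - 1)) (at z)"
    if "z \<in> cut_plane" "c \<in> {0..1}" for z c
    using cut_plane_nonpos_Reals[OF that] by (auto intro!: derivative_eq_intros)
qed (use w open_cut_plane in auto)

text \<open>The binomial expansion of the kernel is integrated term by term; the weight and the
  clamped variable are at most 1 in absolute value, so the binomial series at z dominates.\<close>

lemma stieltjes_power_series:
  assumes w: "w \<in> borel_measurable borel" "\<And>t. \<bar>w t\<bar> \<le> 1" and z: "norm z < 1"
  shows "(\<lambda>n. of_real (pochhammer \<sigma> n / fact n * (LINT t|M. w t * clamp01 t ^ n)) * z ^ n)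
    sums stieltjes M w \<sigma> z"
proof -
  note [measurable] = w(1)
  let ?b = "\<lambda>n. complex_of_real (pochhammer \<sigma> n / fact n)"
  let ?f = "\<lambda>n t. of_real (w t) * (?b n * (z * of_real (clamp01 t)) ^ n)"
  have bound: "norm (?f n t) \<le> norm (?b n * z ^ n)" for n t
  proof -
    have "norm (?f n t) = (\<bar>w t\<bar> * clamp01 t ^ n) * norm (?b n * z ^ n)"
      by (simp add: norm_mult norm_power norm_divide power_mult_distrib)
    also have "\<dots> \<le> 1 * norm (?b n * z ^ n)"
      using w(2) by (intro mult_right_mono mult_le_one power_le_one) auto
    finally show ?thesis by simp
  qed
  \<comment> \<open>Convergence at r yields absolute convergence at the smaller radius |z|.\<close>
  obtain r where r: "norm z < r" "r < 1" using z dense by blast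
  have "summable (\<lambda>n. ?b n * of_real r ^ n)"
    using r order.trans[OF norm_ge_zero less_imp_le[OF r(1)]]
    by (intro sums_summable[OF binomial_series_pochhammer]) auto
  then have summ: "summable (\<lambda>n. norm (?b n * z ^ n))"
    by (rule powser_insidea) (use r norm_ge_zero[of z] in auto)
  have int: "integrable M (?f n)" for n
    by (rule integrable_const_bound[OF AE_I2[OF bound]]) simp
  have int_norm: "(LINT t|M. norm (?f n t)) \<le> norm (?b n * z ^ n)" for n
    by (rule integral_le_const[OF integrable_norm[OF int] AE_I2[OF bound]])
  have "(\<lambda>n. LINT t|M. ?f n t) sums (LINT t|M. (\<Sum>n. ?f n t))"
  proof (rule sums_integral[OF int])
    show "AE t in M. summable (\<lambda>n. norm (?f n t))"
      by (intro AE_I2 summable_comparison_test'[OF summ]) (use bound in auto)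
    show "summable (\<lambda>n. LINT t|M. norm (?f n t))"
      by (rule summable_comparison_test'[OF summ]) (use int_norm in auto)
  qed
  also have "(LINT t|M. (\<Sum>n. ?f n t)) = stieltjes M w \<sigma> z"
    unfolding stieltjes_def
  proof (intro Bochner_Integration.integral_cong refl)
    fix t
    have "norm (z * of_real (clamp01 t)) \<le> norm z"
      by (simp add: norm_mult mult_left_le)
    with z have lt: "norm (z * of_real (clamp01 t)) < 1" by simp
    show "(\<Sum>n. ?f n t) = of_real (w t) * (1 - z * of_real (clamp01 t)) powr of_real (- \<sigma>)"
      by (rule sums_unique[symmetric, OF sums_mult[OF binomial_series_pochhammer[OF lt]]])
  qed
  also have "(\<lambda>n. LINT t|M. ?f n t)
      = (\<lambda>n. of_real (pochhammer \<sigma> n / fact n * (LINT t|M. w t * clamp01 t ^ n)) * z ^ n)"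
  proof
    fix n
    have "(LINT t|M. ?f n t) = (LINT t|M. (?b n * z ^ n) * of_real (w t * clamp01 t ^ n))"
      by (intro Bochner_Integration.integral_cong) (simp_all add: power_mult_distrib)
    also have "\<dots> = (?b n * z ^ n) * of_real (LINT t|M. w t * clamp01 t ^ n)"
      by (simp only: integral_mult_right_zero integral_complex_of_real)
    finally show "(LINT t|M. ?f n t)
        = of_real (pochhammer \<sigma> n / fact n * (LINT t|M. w t * clamp01 t ^ n)) * z ^ n"
      by simp
  qed
  finally show ?thesis .
qed

text \<open>Matching the Taylor coefficients on the unit disc suffices, by uniqueness of the
  continuation. C compensates for the total mass of the weight.\<close>

lemma hypergeo_F_eq_stieltjes:
  assumes w: "w \<in> borel_measurable borel" "\<And>t. \<bar>w t\<bar> \<le> 1"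
    and coeff: "\<And>n. fps_hypergeo as bs 1 $ n
      = of_real (C * (pochhammer \<sigma> n / fact n * (LINT t|M. w t * clamp01 t ^ n)))"
    and z: "z \<in> cut_plane"
  shows "hypergeo_F as bs z = of_real C * stieltjes M w \<sigma> z"
proof (rule hypergeo_F_eqI[OF _ _ z])
  show "(\<lambda>z. of_real C * stieltjes M w \<sigma> z) holomorphic_on cut_plane"
    by (intro holomorphic_intros holomorphic_stieltjes w)
  show "of_real C * stieltjes M w \<sigma> z = eval_fps (fps_hypergeo as bs 1) z" if "z \<in> ball 0 1" for z
    using sums_unique[OF sums_mult[OF stieltjes_power_series[OF w], of z "of_real C" \<sigma>]] that
    unfolding eval_fps_def coeff by (simp add: mult.assoc)
qed

lemma stieltjes_real:
  assumes "x > -1"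
  shows "stieltjes M w \<sigma> (- of_real x) = of_real (LINT t|M. w t * (1 + x * clamp01 t) powr (- \<sigma>))"
proof -
  have "(1 - - complex_of_real x * of_real (clamp01 t)) powr of_real (- \<sigma>)
      = of_real ((1 + x * clamp01 t) powr (- \<sigma>))" for t
    using powr_of_real[OF less_imp_le[OF one_plus_mult_pos[OF assms, of "clamp01 t"]], of "-\<sigma>"] by simp
  then show ?thesis
    unfolding stieltjes_def by (simp only: of_real_mult[symmetric] integral_complex_of_real)
qed

section \<open>Positivity and the correlation inequality\<close>

lemma integral_comp_clamp01_pos:
  fixes P :: "real \<Rightarrow> real"
  assumes "continuous_on {0..1} P" "\<And>c. c \<in> {0..1} \<Longrightarrow> 0 < P c"
  shows "0 < (LINT t|M. P (clamp01 t))"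
proof -
  obtain c0 where c0: "c0 \<in> {0..1}" "\<And>c. c \<in> {0..1} \<Longrightarrow> P c0 \<le> P c"
    using continuous_attains_inf[of "{0..1}" P] assms(1) by auto
  have "P c0 \<le> (LINT t|M. P (clamp01 t))"
    using integrable_comp_clamp01[OF assms(1), of "\<lambda>_. 1"] c0(2)
    by (intro integral_ge_const AE_I2) auto
  then show ?thesis using assms(2)[OF c0(1)] by simp
qed

text \<open>Chebyshev's inequality for the law proportional to P dM: \<open>cross\<close> says
  without division that Q/P is nonincreasing, while t^d increases. The integrand is compared with a
  single point \<open>c0\<close> rather than integrated over pairs.\<close>

lemma weighted_mean_powr_le:
  fixes P Q :: "real \<Rightarrow> real"
  assumes P: "continuous_on {0..1} P" "\<And>c. c \<in> {0..1} \<Longrightarrow> 0 < P c"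
    and Q: "continuous_on {0..1} Q"
    and cross: "\<And>c c'. 0 \<le> c \<Longrightarrow> c \<le> c' \<Longrightarrow> c' \<le> 1 \<Longrightarrow> Q c' * P c \<le> Q c * P c'"
    and d: "d > 0"
  shows "(LINT t|M. clamp01 t powr d * Q (clamp01 t)) * (LINT t|M. P (clamp01 t))
    \<le> (LINT t|M. clamp01 t powr d * P (clamp01 t)) * (LINT t|M. Q (clamp01 t))"
proof -
  let ?c = clamp01
  have int: "integrable M (\<lambda>t. f (?c t))" "integrable M (\<lambda>t. ?c t powr d * f (?c t))"
    if "continuous_on {0..1} f" for f :: "real \<Rightarrow> real"
    using integrable_comp_clamp01[OF that, of "\<lambda>_. 1"]
      integrable_comp_clamp01[OF that, of "\<lambda>t. ?c t powr d"] clamp01_powr_le_1[of d] d by simp_all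
  define IP IQ JP JQ where "IP = (LINT t|M. P (?c t))" and "IQ = (LINT t|M. Q (?c t))"
    and "JP = (LINT t|M. ?c t powr d * P (?c t))" and "JQ = (LINT t|M. ?c t powr d * Q (?c t))"
  have IP: "IP > 0" unfolding IP_def using P by (rule integral_comp_clamp01_pos)
  have Ppos: "P (?c t) > 0" for t by (rule P) auto
  have "0 \<le> JP"
    unfolding JP_def using Ppos by (intro integral_nonneg_AE AE_I2) (simp add: less_imp_le)
  moreover have "JP \<le> IP"
    unfolding JP_def IP_def using int P Ppos d
    by (intro integral_mono) (auto intro: mult_left_le_one_le clamp01_powr_le_1 less_imp_le)
  ultimately have \<kappa>: "0 \<le> JP / IP" "JP / IP \<le> 1" using IP by simp_all
  have \<kappa>': "\<bar>JP\<bar> / \<bar>IP\<bar> = JP / IP" using \<kappa>(1) by (metis abs_divide abs_of_nonneg)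
  \<comment> \<open>\<open>c0\<close> is where the weight equals its \<open>P\<close>-mean; there both factors of the integrand below change sign.\<close>
  define c0 where "c0 = (JP / IP) powr (1 / d)"
  have c0: "c0 \<in> {0..1}" "c0 powr d = JP / IP"
    using \<kappa> d powr_mono2[of "1/d" "JP / IP" 1] by (simp_all add: c0_def powr_powr \<kappa>')
  have "(?c t powr d - c0 powr d) * (P c0 * Q (?c t) - Q c0 * P (?c t)) \<le> 0" for t
  proof (cases "c0 \<le> ?c t")
    case True
    then have "c0 powr d \<le> ?c t powr d" using c0 d by (intro powr_mono2) auto
    then show ?thesis
      using cross[of c0 "?c t"] True c0 by (intro mult_nonneg_nonpos) (auto simp: mult.commute)
  next
    case False
    then have "?c t powr d \<le> c0 powr d" using d by (intro powr_mono2) auto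
    then show ?thesis
      using cross[of "?c t" c0] False c0 by (intro mult_nonpos_nonneg) (auto simp: mult.commute)
  qed
  then have "0 \<le> (LINT t|M. - ((?c t powr d - c0 powr d) * (P c0 * Q (?c t) - Q c0 * P (?c t))))"
    by (intro integral_nonneg_AE AE_I2) simp
  then have "(LINT t|M. (?c t powr d - c0 powr d) * (P c0 * Q (?c t) - Q c0 * P (?c t))) \<le> 0"
    by simp
  also have "(\<lambda>t. (?c t powr d - c0 powr d) * (P c0 * Q (?c t) - Q c0 * P (?c t)))
      = (\<lambda>t. (P c0 * (?c t powr d * Q (?c t)) - P c0 * c0 powr d * Q (?c t))
        - (Q c0 * (?c t powr d * P (?c t)) - Q c0 * c0 powr d * P (?c t)))"
    by (auto simp: algebra_simps)
  also have "integral\<^sup>L M \<dots> = (P c0 * JQ - P c0 * c0 powr d * IQ) - (Q c0 * JP - Q c0 * c0 powr d * IP)"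
    using int P Q by (simp add: IP_def IQ_def JP_def JQ_def)
  \<comment> \<open>By the choice of \<open>c0\<close>, \<open>c0 powr d * IP = JP\<close>.\<close>
  also have "Q c0 * JP - Q c0 * c0 powr d * IP = 0"
    using IP by (simp add: c0)
  finally have "P c0 * JQ \<le> P c0 * (JP / IP * IQ)" by (simp add: c0 mult.assoc)
  then have "JQ \<le> JP / IP * IQ" by (simp only: mult_le_cancel_left_pos[OF P(2)[OF c0(1)]])
  then have "JQ * IP \<le> JP * IQ" using IP by (simp add: field_simps)
  then show ?thesis by (simp add: IP_def IQ_def JP_def JQ_def)
qed

end

section \<open>The ratio of hypergeometric functions\<close>

lemma foldl_pochhammer_of_real:
  "foldl (\<lambda>r a. r * pochhammer a n) c (map complex_of_real xs)
    = c * of_real (\<Prod>i<length xs. pochhammer (xs ! i) n)"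
  by (induction xs rule: rev_induct)
     (simp_all add: pochhammer_of_real nth_append mult.assoc cong: prod.cong_simp)

lemma real_fps_hypergeo_nth:
  assumes "length A = length B"
  shows "fps_hypergeo (map complex_of_real (\<sigma> # A)) (map complex_of_real B) 1 $ n
    = of_real (pochhammer \<sigma> n / fact n * (\<Prod>i<length B. pochhammer (A ! i) n / pochhammer (B ! i) n))"
  using assms by (simp add: foldl_pochhammer_of_real prod_dividef pochhammer_of_real)

text \<open>Reduces moments of order s + n to the Pochhammer symbols in the hypergeometric
  coefficients.\<close>

lemma Gamma_ratio_add_nat:
  fixes a s :: real
  assumes "0 < a" "0 \<le> s"
  shows "Gamma (a + (s + real n)) / Gamma a = Gamma (a + s) / Gamma a * pochhammer (a + s) n"
proof -
  have "a + s > 0" using assms by simp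
  then have "a + s \<notin> \<int>\<^sub>\<le>\<^sub>0" "Gamma (a + s) \<noteq> 0"
    by (auto elim!: nonpos_Ints_cases simp: less_imp_neq[OF Gamma_real_pos, symmetric])
  then show ?thesis by (simp add: pochhammer_Gamma add.assoc)
qed

text \<open>The two products of bases differ by (y - x)(c' - c); the power -\<sigma> reverses order
  for \<sigma> > 0 and keeps it for \<sigma> < 0. The disjunction serves both halves of the theorem
  at once.\<close>

lemma stieltjes_kernel_cross:
  fixes x y :: real
  assumes "-1 < x" "-1 < y" "0 \<le> c" "c \<le> c'" "c' \<le> 1"
    and "0 < \<sigma> \<and> x \<le> y \<or> \<sigma> < 0 \<and> y \<le> x"
  shows "(1 + y * c') powr (- \<sigma>) * (1 + x * c) powr (- \<sigma>)
    \<le> (1 + y * c) powr (- \<sigma>) * (1 + x * c') powr (- \<sigma>)"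
proof -
  have p: "0 < 1 + x * c" "0 < 1 + x * c'" "0 < 1 + y * c" "0 < 1 + y * c'"
    by (rule one_plus_mult_pos; use assms in auto)+
  have id: "(1 + y * c') * (1 + x * c) - (1 + y * c) * (1 + x * c') = (y - x) * (c' - c)"
    by algebra
  from assms(6) have "((1 + y * c') * (1 + x * c)) powr (- \<sigma>)
      \<le> ((1 + y * c) * (1 + x * c')) powr (- \<sigma>)"
  proof
    assume *: "0 < \<sigma> \<and> x \<le> y"
    then have "0 \<le> (y - x) * (c' - c)" using assms by simp
    then show ?thesis using id p * by (intro powr_mono2') auto
  next
    assume *: "\<sigma> < 0 \<and> y \<le> x"
    then have "(y - x) * (c' - c) \<le> 0" using assms by (simp add: mult_nonpos_nonneg)
    then show ?thesis using id p * by (intro powr_mono2) auto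
  qed
  then show ?thesis using p by (simp add: powr_mult)
qed

text \<open>\<open>hypergeo_F\<close> has complex values; a nonzero denominator and a real quotient
  are asserted as well, so that monotonicity of the real part is monotonicity of the quotient
  itself.\<close>

theorem theorem4:
  fixes q :: nat and A B :: "real list" and \<delta> \<sigma> :: real
  assumes "q \<ge> 1" and "length A = q" and "length B = q"
    and "B \<prec>\<^sup>W A" and "\<delta> > 0"
  shows "let R = (\<lambda>x::real.
               real_hypergeo_F \<sigma> (A +\<^sub>v \<delta>) (B +\<^sub>v \<delta>) (- complex_of_real x) /
               real_hypergeo_F \<sigma> A B (- complex_of_real x))
         in (\<forall>x>-1. real_hypergeo_F \<sigma> A B (- complex_of_real x) \<noteq> 0 \<and> R x \<in> \<real>) \<and>
            (\<sigma> > 0 \<longrightarrow> antimono_on {-1<..} (\<lambda>x. Re (R x))) \<and>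
            (\<sigma> < 0 \<longrightarrow> mono_on {-1<..} (\<lambda>x. Re (R x)))"
proof -
  have lenA: "length A = q" and lenB: "length B = q" and \<delta>: "\<delta> > 0" by fact+
  have A_pos: "0 < A ! i" and B_pos: "0 < B ! i" if "i < q" for i
    using assms that by (auto simp: weak_supermajorized_def)
  define f where "f s = (\<Prod>i<q. (Gamma (A ! i + s) / Gamma (A ! i)) / (Gamma (B ! i + s) / Gamma (B ! i)))" for s
  have "\<exists>M. unit_mellin M f"
    unfolding f_def[abs_def]
  proof (rule unit_mellin_Gamma_ratio)
    show "B ! i \<le> B ! j" if "i \<le> j" "j < q" for i j
      using assms that by (auto simp: weak_supermajorized_def intro: sorted_nth_mono)
    show "(\<Sum>i<k. A ! i) \<le> (\<Sum>i<k. B ! i)" if k: "k \<le> q" for k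
    proof (cases "k = 0")
      case False
      have "sum_list (take k X) = (\<Sum>i<k. X ! i)" if "length X = q" for X :: "real list"
        using that k by (simp add: sum_list_sum_nth atLeast0LessThan)
      then have "sum_list (take k A) = (\<Sum>i<k. A ! i)" "sum_list (take k B) = (\<Sum>i<k. B ! i)"
        using lenA lenB by blast+
      moreover have "sum_list (take k A) \<le> sum_list (take k B)"
        using assms k False by (simp add: weak_supermajorized_def)
      ultimately show ?thesis by simp
    qed simp
  qed (use A_pos B_pos in auto)
  then obtain M where M: "unit_mellin M f" ..
  interpret real_distribution M using M by (simp add: unit_mellin_def)
  have f_add: "f (s + real n) = f s * (\<Prod>i<q. pochhammer (A ! i + s) n / pochhammer (B ! i + s) n)"
    if "s \<ge> 0" for s n
    unfolding f_def prod.distrib[symmetric]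
  proof (intro prod.cong refl)
    fix i assume "i \<in> {..<q}"
    then have "0 < A ! i" "0 < B ! i" using A_pos B_pos by auto
    then show "Gamma (A ! i + (s + real n)) / Gamma (A ! i) / (Gamma (B ! i + (s + real n)) / Gamma (B ! i))
      = Gamma (A ! i + s) / Gamma (A ! i) / (Gamma (B ! i + s) / Gamma (B ! i))
        * (pochhammer (A ! i + s) n / pochhammer (B ! i + s) n)"
      using that by (simp only: Gamma_ratio_add_nat times_divide_times_eq)
  qed
  have f0: "f 0 = 1" using M by (simp add: unit_mellin_def)
  have f\<delta>: "f \<delta> > 0"
    unfolding f_def using A_pos B_pos \<delta> by (intro prod_pos) (auto simp: Gamma_real_pos add_pos_pos)
  have moment: "(LINT t|M. clamp01 t ^ n) = (\<Prod>i<q. pochhammer (A ! i) n / pochhammer (B ! i) n)" for n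
  \<comment> \<open>The case n = 0 stands apart: where the clamped value is 0 its power
    \<open>^ 0\<close> is 1, but \<open>0 powr 0 = 0\<close>.\<close>
  proof (cases "n = 0")
    case True
    then show ?thesis using prob_space by simp
  next
    case False
    then have "(LINT t|M. clamp01 t ^ n) = f (real n)"
      using M by (simp add: unit_mellin_def powr_realpow'[symmetric])
    then show ?thesis using f_add[of 0 n] f0 by simp
  qed
  have moment_\<delta>: "(LINT t|M. clamp01 t powr \<delta> * clamp01 t ^ n)
      = f \<delta> * (\<Prod>i<q. pochhammer (A ! i + \<delta>) n / pochhammer (B ! i + \<delta>) n)" for n
  proof -
    \<comment> \<open>Both sides vanish where the clamped value is 0, and the order \<delta> + n is
      positive even for n = 0, so no case split on n arises.\<close>
    have "clamp01 t powr \<delta> * clamp01 t ^ n = clamp01 t powr (\<delta> + real n)" for t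
      by (cases "clamp01 t = 0") (simp_all add: powr_add powr_realpow less_le)
    then have "(LINT t|M. clamp01 t powr \<delta> * clamp01 t ^ n) = f (\<delta> + real n)"
      using M \<delta> by (simp add: unit_mellin_def)
    then show ?thesis using f_add[of \<delta> n] \<delta> by simp
  qed
  define D where "D x = (LINT t|M. (1 + x * clamp01 t) powr (- \<sigma>))" for x
  define N where "N x = (LINT t|M. clamp01 t powr \<delta> * (1 + x * clamp01 t) powr (- \<sigma>))" for x
  have in_cut: "- complex_of_real x \<in> cut_plane" if "x > -1" for x
    using that by (auto simp: cut_plane_def simp flip: of_real_minus)
  have FD: "real_hypergeo_F \<sigma> A B (- complex_of_real x) = of_real (D x)" if x: "x > -1" for x
    using hypergeo_F_eq_stieltjes[of "\<lambda>_. 1" _ _ 1 \<sigma>, OF _ _ _ in_cut[OF x]] real_fps_hypergeo_nth[of A B \<sigma>]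
    by (simp add: lenA lenB moment stieltjes_real[OF x] D_def del: fps_hypergeo_nth list.map)
  \<comment> \<open>The series has constant term 1, whereas the weight has total mass
    \<open>f \<delta>\<close>; hence the division.\<close>
  have FN: "real_hypergeo_F \<sigma> (A +\<^sub>v \<delta>) (B +\<^sub>v \<delta>) (- complex_of_real x) = of_real (N x / f \<delta>)"
    if x: "x > -1" for x
  proof -
    have "real_hypergeo_F \<sigma> (A +\<^sub>v \<delta>) (B +\<^sub>v \<delta>) (- complex_of_real x)
        = of_real (1 / f \<delta>) * stieltjes M (\<lambda>t. clamp01 t powr \<delta>) \<sigma> (- complex_of_real x)"
    proof (rule hypergeo_F_eq_stieltjes[OF _ _ _ in_cut[OF x]])
      show "fps_hypergeo (map complex_of_real (\<sigma> # (A +\<^sub>v \<delta>))) (map complex_of_real (B +\<^sub>v \<delta>)) 1 $ n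
        = of_real (1 / f \<delta> * (pochhammer \<sigma> n / fact n * (LINT t|M. clamp01 t powr \<delta> * clamp01 t ^ n)))" for n
        using f\<delta> by (subst real_fps_hypergeo_nth) (simp_all add: vec_shift_def lenA lenB moment_\<delta>)
    qed (use \<delta> in \<open>auto simp: clamp01_powr_le_1\<close>)
    then show ?thesis by (simp add: stieltjes_real[OF x] N_def)
  qed
  have kernel_cont: "continuous_on {0..1} (\<lambda>c. (1 + x * c) powr (- \<sigma>))" if "x > -1" for x
    using one_plus_mult_pos[OF that] by (intro continuous_intros ballI) (metis less_irrefl)
  have kernel_pos: "0 < (1 + x * c) powr (- \<sigma>)" if "x > -1" "c \<in> {0..1}" for x c
    using one_plus_mult_pos[OF that] by (metis less_irrefl powr_gt_zero)
  have D_pos: "D x > 0" if "x > -1" for x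
    unfolding D_def by (intro integral_comp_clamp01_pos kernel_cont kernel_pos that)
  have cross: "N y / D y \<le> N x / D x"
    if "x > -1" "y > -1" "0 < \<sigma> \<and> x \<le> y \<or> \<sigma> < 0 \<and> y \<le> x" for x y
  proof -
    \<comment> \<open>The correlation inequality, with the kernel at x as \<open>P\<close> and the
      kernel at y as \<open>Q\<close>.\<close>
    have "N y * D x \<le> N x * D y"
      unfolding N_def D_def
      using \<delta> that stieltjes_kernel_cross
      by (intro weighted_mean_powr_le[of "\<lambda>c. (1 + x * c) powr (- \<sigma>)" "\<lambda>c. (1 + y * c) powr (- \<sigma>)"]
          kernel_cont kernel_pos) blast+
    then show ?thesis using D_pos that by (simp add: field_simps)
  qed
  define R where "R x = real_hypergeo_F \<sigma> (A +\<^sub>v \<delta>) (B +\<^sub>v \<delta>) (- complex_of_real x) /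
    real_hypergeo_F \<sigma> A B (- complex_of_real x)" for x
  have R: "R x = of_real (N x / D x / f \<delta>)" if "x > -1" for x
    by (simp add: R_def FN[OF that] FD[OF that] mult.commute del: list.map)
  have Re_R: "Re (R y) \<le> Re (R x)"
    if "x > -1" "y > -1" "0 < \<sigma> \<and> x \<le> y \<or> \<sigma> < 0 \<and> y \<le> x" for x y
    unfolding R[OF that(1)] R[OF that(2)] Re_complex_of_real
    using cross[OF that] f\<delta> by (intro divide_right_mono) auto
  have "real_hypergeo_F \<sigma> A B (- complex_of_real x) \<noteq> 0 \<and> R x \<in> \<real>" if "x > -1" for x
    using D_pos[OF that] by (simp add: R[OF that] FD[OF that] del: list.map of_real_divide)
  moreover have "antimono_on {-1<..} (\<lambda>x. Re (R x))" if "\<sigma> > 0"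
    using that by (intro monotone_onI Re_R) auto
  moreover have "mono_on {-1<..} (\<lambda>x. Re (R x))" if "\<sigma> < 0"
    using that by (intro monotone_onI Re_R) auto
  ultimately show ?thesis
    unfolding Let_def R_def[symmetric] by blast
qed

end
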